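(* Let $n\ge2$ and let $T$ be an operator, defined on $C_c^\infty(\mathbb{R}^n)$ with values in measurable functions on $\mathbb{R}^n$, for which there is a constant $C_0$ such that $$|Tf(x)|\le C_0\,I_1(|\nabla f|)(x),\qquad f\in C_c^\infty(\mathbb{R}^n).$$ Then for every $0<r<n'$ there is a constant $C$ (independent of $f$ and $x$) such that $$M_{L^r}(Tf)(x)\le C\,I_1(|\nabla f|)(x),\qquad f\in C_c^\infty(\mathbb{R}^n).$$
   Context: Here $n'=\frac n{n-1}$, $I_1g(x)=\int_{\mathbb{R}^n}\frac{g(y)}{|x-y|^{n-1}}\,dy$ is the Riesz potential of order 1, and $M_{L^r}g(x)=\sup_{Q\ni x}\left(\frac1{|Q|}\int_Q|g|^r\right)^{1/r}$, the supremum being over cubes $Q$ with sides parallel to the axes containing $x$. *)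

theory Defs
  imports "HOL-Analysis.Analysis"
begin

text \<open>Scalar functions take values in a type of class \<open>real_normed_field\<close>, whose instances are
  the real and the complex numbers up to isomorphism.\<close>

text \<open>In finite dimension, \<open>f\<close> is of class C\<open>\<^sup>k\<^sup>+\<^sup>1\<close> iff it is differentiable and all
  its directional derivatives are of class C\<open>\<^sup>k\<close>.\<close>

primrec C_k :: "nat \<Rightarrow> ('a::euclidean_space \<Rightarrow> 'b::real_normed_vector) \<Rightarrow> bool" where
  "C_k 0 f \<longleftrightarrow> continuous_on UNIV f"
| "C_k (Suc k) f \<longleftrightarrow> f differentiable_on UNIV \<and> (\<forall>v. C_k k (\<lambda>x. frechet_derivative f (at x) v))"

definition Cc_infinity :: "('a::euclidean_space \<Rightarrow> 'b::real_normed_vector) set" where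
  "Cc_infinity = {f. (\<forall>k. C_k k f) \<and> compact (closure {x. f x \<noteq> 0})}"

text \<open>The norm of the type \<open>'b^'n\<close> is the Euclidean norm of the vector of partial derivatives.\<close>

definition gradient :: "(real^'n \<Rightarrow> 'b::real_normed_vector) \<Rightarrow> real^'n \<Rightarrow> 'b^'n" where
  "gradient f x = (\<chi> i. frechet_derivative f (at x) (axis i 1))"

text \<open>The integrand has the value \<open>0\<close> at \<open>y = x\<close>, by division by zero; this is a null set.
  For bounded measurable \<open>g\<close> of compact support the integral converges absolutely.\<close>

definition riesz_potential_1 :: "(real^'n \<Rightarrow> real) \<Rightarrow> real^'n \<Rightarrow> real" where
  "riesz_potential_1 g x = (LINT y|lebesgue. g y / norm (x - y) ^ (CARD('n) - 1))"

text \<open>Cubes are closed and nondegenerate.\<close>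

definition cubes :: "(real^'n) set set" where
  "cubes = {cbox a b | a b. \<exists>l>0. \<forall>i. b $ i - a $ i = l}"

text \<open>Real powers on \<open>[0, \<infinity>]\<close>, for positive exponents \<open>p\<close> only.\<close>

definition ennreal_powr :: "ennreal \<Rightarrow> real \<Rightarrow> ennreal" where
  "ennreal_powr a p = (if a = \<infinity> then \<infinity> else ennreal (enn2real a powr p))"

definition maximal_Lr :: "real \<Rightarrow> (real^'n \<Rightarrow> 'b::real_normed_vector) \<Rightarrow> real^'n \<Rightarrow> ennreal" where
  "maximal_Lr r g x =
    (SUP Q\<in>{Q\<in>cubes. x \<in> Q}.
      ennreal_powr ((\<integral>\<^sup>+y\<in>Q. ennreal (norm (g y) powr r) \<partial>lebesgue) / emeasure lebesgue Q) (1 / r))"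

end

theory Submission
  imports Defs
begin

text \<open>Write \<open>g = |\<nabla>f|\<close> and \<open>k(x, y) = |x - y|\<^sup>-\<^sup>(\<^sup>n\<^sup>-\<^sup>1\<^sup>)\<close>. Since \<open>|Tf|\<close> is at most a
  multiple of \<open>I\<^sub>1 g\<close> everywhere, only the potential matters, and the claim is that \<open>(I\<^sub>1 g)\<^sup>r\<close> behaves like a
  Muckenhoupt \<open>A\<^sub>1\<close> weight: its average over any cube \<open>Q\<close> is at most a constant times its value at
  any point \<open>x\<close> of \<open>Q\<close> (\<open>cube_average_riesz_potential_1_powr_le\<close>).

  The kernel itself has this property. If \<open>0 \<le> p < n\<close>, then \<open>|z|\<^sup>-\<^sup>p\<close> is locally integrable, and
  its integral over a ball of radius \<open>l\<close> scales like \<open>l\<^sup>n\<^sup>-\<^sup>p\<close>; hence the average over \<open>z \<in> Q\<close> of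
  \<open>(|x - y| / |z - y|)\<^sup>p\<close> is bounded uniformly in \<open>x \<in> Q\<close>, in \<open>y\<close> and in the cube
  (\<open>nn_integral_kernel_ratio_le\<close>).

  To pass from the kernel to the potential when \<open>s \<ge> 1\<close>, let \<open>m = I\<^sub>1 g(x)\<close> and regard
  \<open>g(y) k(x, y) dy / m\<close> as a probability measure. Then \<open>I\<^sub>1 g(z) / m\<close> is the mean of
  \<open>k(z, y) / k(x, y)\<close>, so by Jensen's inequality \<open>(I\<^sub>1 g(z) / m)\<^sup>s\<close> is at most the mean of
  \<open>(|x - y| / |z - y|)\<^sup>p\<close> with \<open>p = s(n - 1)\<close> (\<open>riesz_potential_1_quotient_powr_le\<close>). Integrating
  over \<open>z \<in> Q\<close> and exchanging the integrals reduces the claim to the kernel. The condition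
  \<open>p < n\<close> is \<open>s < n'\<close>, which is where the range of \<open>r\<close> comes from. With \<open>s = max 1 r\<close>, exponents
  \<open>r < 1\<close> are covered by \<open>t\<^sup>r \<le> 1 + t\<^sup>s\<close>.\<close>

section \<open>Averages of the kernel over a set containing the base point\<close>

lemma exists_dyadic_shell:
  fixes t l :: real
  assumes "0 < t" "t \<le> l"
  obtains k :: nat where "l / 2 ^ Suc k < t" "t \<le> l / 2 ^ k"
proof -
  have "\<exists>k. l / 2 ^ Suc k < t"
  proof -
    obtain k where "l / t < 2 ^ k"
      using real_arch_pow[of 2 "l / t"] by auto
    hence "l < t * 2 ^ k" using assms by (simp add: field_simps)
    hence "l / 2 ^ k < t" by (simp add: field_simps)
    moreover have "l / 2 ^ Suc k \<le> l / 2 ^ k" using assms by (simp add: field_simps)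
    ultimately show ?thesis by (intro exI[of _ k]) linarith
  qed
  then obtain k where k: "l / 2 ^ Suc k < t" "\<And>j. j < k \<Longrightarrow> \<not> l / 2 ^ Suc j < t"
    using exists_least_iff[of "\<lambda>k. l / 2 ^ Suc k < t"] by blast
  have "t \<le> l / 2 ^ k"
  proof (cases k)
    case 0 thus ?thesis using assms by simp
  next
    case (Suc j) thus ?thesis using k(2)[of j] by auto
  qed
  with k(1) show thesis by (rule that)
qed

text \<open>Cut the ball into the dyadic shells \<open>l / 2\<^sup>k\<^sup>+\<^sup>1 < |z - y| \<le> l / 2\<^sup>k\<close>. On each of them the
  integrand is comparable to a constant, and the contributions form a geometric series of ratio
  \<open>2\<^sup>p\<^sup>-\<^sup>n < 1\<close>.\<close>

lemma nn_integral_norm_powr_cball_le: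
  fixes p :: real
  assumes "0 \<le> p" "p < real DIM('a::euclidean_space)"
  obtains K :: real where "0 \<le> K"
    "\<And>(y::'a) l. 0 < l \<Longrightarrow>
      (\<integral>\<^sup>+z\<in>cball y l. ennreal (norm (z - y) powr - p) \<partial>lborel) \<le> ennreal (K * l powr (real DIM('a) - p))"
proof -
  let ?n = "DIM('a)"
  let ?w = "unit_ball_vol (real ?n)"
  define q :: real where "q = 2 powr (p - ?n)"
  have q: "0 < q" "q < 1"
    using assms powr_less_mono[of "p - ?n" 0 2] by (auto simp: q_def)
  define K where "K = 2 powr p * ?w * (1 / (1 - q))"
  have "(\<integral>\<^sup>+z\<in>cball y l. ennreal (norm (z - y) powr - p) \<partial>lborel) \<le> ennreal (K * l powr (real ?n - p))"
    if "0 < l" for y :: 'a and l :: real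
  proof -
    define F :: "nat \<Rightarrow> 'a \<Rightarrow> ennreal"
      where "F k z = ennreal ((l / 2 ^ Suc k) powr - p) * indicator (cball y (l / 2 ^ k)) z" for k z
    have F_meas: "F k \<in> borel_measurable lborel" for k
      unfolding F_def by (intro borel_measurable_times_ennreal borel_measurable_indicator) auto
    \<comment> \<open>The centre \<open>z = y\<close> lies in no shell; there the left side is \<open>0 powr - p = 0\<close>.\<close>
    have pt: "ennreal (norm (z - y) powr - p) * indicator (cball y l) z \<le> (\<Sum>k. F k z)" for z
    proof (cases "z \<noteq> y \<and> norm (z - y) \<le> l")
      case True
      then obtain k where k: "l / 2 ^ Suc k < norm (z - y)" "norm (z - y) \<le> l / 2 ^ k"
        using exists_dyadic_shell[of "norm (z - y)" l] by auto
      have "norm (z - y) powr - p \<le> (l / 2 ^ Suc k) powr - p"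
        using k(1) \<open>0 < l\<close> \<open>0 \<le> p\<close> by (intro powr_mono2') auto
      hence "ennreal (norm (z - y) powr - p) * indicator (cball y l) z \<le> F k z"
        using k(2) True by (auto simp: F_def indicator_def dist_norm norm_minus_commute intro!: ennreal_leI)
      also have "\<dots> = sum (\<lambda>k. F k z) {k}"
        by (simp only: sum.insert finite.emptyI sum.empty empty_iff not_False_eq_True add_0_right)
      also have "\<dots> \<le> (\<Sum>k. F k z)"
        by (rule sum_le_suminf) auto
      finally show ?thesis .
    next
      case False
      thus ?thesis by (auto simp: indicator_def dist_norm norm_minus_commute)
    qed
    have "(\<integral>\<^sup>+z\<in>cball y l. ennreal (norm (z - y) powr - p) \<partial>lborel) \<le> (\<integral>\<^sup>+z. (\<Sum>k. F k z) \<partial>lborel)"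
      by (rule nn_integral_mono) (rule pt)
    also have "\<dots> = (\<Sum>k. \<integral>\<^sup>+z. F k z \<partial>lborel)"
      by (rule nn_integral_suminf[OF F_meas])
    also have "\<dots> = (\<Sum>k. ennreal (2 powr p * ?w * l powr (real ?n - p) * q ^ k))"
    proof (rule suminf_cong)
      fix k :: nat
      have "(\<integral>\<^sup>+z. F k z \<partial>lborel) = ennreal ((l / 2 ^ Suc k) powr - p) * emeasure lborel (cball y (l / 2 ^ k))"
        unfolding F_def by (rule nn_integral_cmult_indicator) auto
      also have "\<dots> = ennreal ((l / 2 ^ Suc k) powr - p * (?w * (l / 2 ^ k) ^ ?n))"
        using \<open>0 < l\<close> by (simp add: emeasure_cball ennreal_mult')
      also have "(l / 2 ^ Suc k) powr - p * (?w * (l / 2 ^ k) ^ ?n) = 2 powr p * ?w * l powr (real ?n - p) * q ^ k"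
      proof -
        have pow2: "(2::real) ^ j = 2 powr real j" for j
          by (rule powr_realpow[symmetric]) simp
        have "l / 2 ^ Suc k = l * 2 powr - (1 + real k)"
          unfolding pow2 by (simp only: powr_minus divide_inverse of_nat_Suc)
        hence e1: "(l / 2 ^ Suc k) powr - p = l powr - p * 2 powr p * 2 powr (k * p)"
          using \<open>0 < l\<close> by (simp add: powr_mult powr_powr mult.assoc powr_add[symmetric]) (simp add: algebra_simps)
        have "(l / 2 ^ k) ^ ?n = (l * 2 powr - real k) powr real ?n"
          unfolding pow2 using \<open>0 < l\<close>
          by (subst powr_realpow) (auto simp only: powr_minus divide_inverse intro!: mult_pos_pos; simp)+
        hence e2: "(l / 2 ^ k) ^ ?n = l powr ?n * 2 powr (- (k * real ?n))"
          using \<open>0 < l\<close> by (simp only: powr_mult powr_powr mult_minus_left)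
        have e3: "q ^ k = 2 powr (k * p) * 2 powr (- (k * real ?n))"
          using q(1) unfolding q_def
          by (simp only: powr_realpow[symmetric] powr_powr powr_add[symmetric]) (simp add: algebra_simps)
        have e4: "l powr (real ?n - p) = l powr ?n * l powr - p"
          by (simp add: powr_add[symmetric])
        show ?thesis unfolding e1 e2 e3 e4 by (simp add: algebra_simps)
      qed
      finally show "(\<integral>\<^sup>+z. F k z \<partial>lborel) = ennreal (2 powr p * ?w * l powr (real ?n - p) * q ^ k)" .
    qed
    also have "\<dots> = ennreal (2 powr p * ?w * l powr (real ?n - p) * (1 / (1 - q)))"
      using q by (intro suminf_ennreal_eq sums_mult geometric_sums) (auto intro!: mult_nonneg_nonneg)
    finally show ?thesis by (simp add: K_def mult_ac)
  qed
  moreover have "0 \<le> K" using q by (simp add: K_def)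
  ultimately show thesis using that by blast
qed

text \<open>If \<open>y\<close> is at distance more than \<open>l\<close> from \<open>z\<close>, moving \<open>z\<close> to \<open>x\<close> changes the distance to \<open>y\<close> by a
  bounded factor only, and the ratio is at most \<open>D + 1\<close>. Otherwise \<open>|x - y| \<le> (D + 1) l\<close>, and the
  singularity \<open>|z - y|\<^sup>-\<^sup>p\<close> is integrated over the ball of radius \<open>l\<close> about \<open>y\<close>, which gives
  \<open>l\<^sup>p l\<^sup>n\<^sup>-\<^sup>p\<close>, a multiple of the volume of \<open>Q\<close>.\<close>

lemma nn_integral_kernel_ratio_le:
  fixes p D :: real
  assumes "0 \<le> p" "p < real DIM('a::euclidean_space)" "0 \<le> D"
  obtains C :: real where "0 \<le> C"
    "\<And>(Q::'a set) l x y. 0 < l \<Longrightarrow> Q \<in> sets borel \<Longrightarrow> emeasure lborel Q = ennreal (l ^ DIM('a)) \<Longrightarrow>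
      (\<And>z. z \<in> Q \<Longrightarrow> norm (x - z) \<le> D * l) \<Longrightarrow>
      (\<integral>\<^sup>+z\<in>Q. ennreal ((norm (x - y) / norm (z - y)) powr p) \<partial>lborel) \<le> ennreal C * emeasure lborel Q"
proof -
  let ?n = "DIM('a)"
  obtain K where K: "0 \<le> K"
    "\<And>(y::'a) l. 0 < l \<Longrightarrow>
      (\<integral>\<^sup>+z\<in>cball y l. ennreal (norm (z - y) powr - p) \<partial>lborel) \<le> ennreal (K * l powr (real ?n - p))"
    using nn_integral_norm_powr_cball_le[OF assms(1,2)] by blast
  let ?A = "(D + 1) powr p"
  define C where "C = ?A * (1 + K)"
  have "(\<integral>\<^sup>+z\<in>Q. ennreal ((norm (x - y) / norm (z - y)) powr p) \<partial>lborel) \<le> ennreal C * emeasure lborel Q"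
    if "0 < l" and [measurable]: "Q \<in> sets borel" and Q: "emeasure lborel Q = ennreal (l ^ ?n)"
      and diam: "\<And>z. z \<in> Q \<Longrightarrow> norm (x - z) \<le> D * l" for Q :: "'a set" and l x y
  proof -
    have pt: "ennreal ((norm (x - y) / norm (z - y)) powr p) * indicator Q z
      \<le> ennreal ?A * indicator Q z
        + ennreal (?A * l powr p) * (ennreal (norm (z - y) powr - p) * indicator (cball y l) z)" for z
    proof (cases "z \<in> Q \<and> z \<noteq> y")
      case True
      have tri: "norm (x - y) \<le> D * l + norm (z - y)"
        using norm_triangle_ineq[of "x - z" "z - y"] diam[of z] True by simp
      have pos: "0 < norm (z - y)" using True by simp
      show ?thesis
      proof (cases "norm (z - y) \<le> l")
        case near: True
        have "norm (x - y) powr p \<le> ((D + 1) * l) powr p"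
          using tri near assms by (intro powr_mono2) (auto simp: algebra_simps)
        also have "\<dots> = ?A * l powr p"
          using \<open>0 < l\<close> assms by (simp add: powr_mult)
        finally have "norm (x - y) powr p * norm (z - y) powr - p \<le> ?A * l powr p * norm (z - y) powr - p"
          by (rule mult_right_mono) simp
        hence "(norm (x - y) / norm (z - y)) powr p \<le> ?A * l powr p * norm (z - y) powr - p"
          by (subst powr_divide) (simp_all add: powr_minus divide_inverse)
        hence "ennreal ((norm (x - y) / norm (z - y)) powr p)
            \<le> ennreal (?A * l powr p) * ennreal (norm (z - y) powr - p)"
          by (subst ennreal_mult'[symmetric]) (auto intro: ennreal_leI)
        moreover have "z \<in> cball y l" using near by (simp add: dist_norm norm_minus_commute)
        ultimately show ?thesis using True by (simp add: add_increasing)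
      next
        case far: False
        have "D * l \<le> D * norm (z - y)" using far assms by (intro mult_left_mono) auto
        hence "norm (x - y) / norm (z - y) \<le> D + 1"
          using tri pos by (simp add: pos_divide_le_eq distrib_right)
        hence "(norm (x - y) / norm (z - y)) powr p \<le> ?A"
          using assms by (intro powr_mono2) auto
        hence "ennreal ((norm (x - y) / norm (z - y)) powr p) \<le> ennreal ?A"
          by (rule ennreal_leI)
        thus ?thesis using True by (simp add: add_increasing2)
      qed
    qed auto
    define H where "H z = ennreal (norm (z - y) powr - p) * indicator (cball y l) z" for z
    have H: "H \<in> borel_measurable lborel"
      unfolding H_def by (intro borel_measurable_times_ennreal borel_measurable_indicator) auto
    have "(\<integral>\<^sup>+z\<in>Q. ennreal ((norm (x - y) / norm (z - y)) powr p) \<partial>lborel)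
      \<le> (\<integral>\<^sup>+z. (ennreal ?A * indicator Q z + ennreal (?A * l powr p) * H z) \<partial>lborel)"
      unfolding H_def by (rule nn_integral_mono) (rule pt)
    also have "\<dots> = (\<integral>\<^sup>+z. ennreal ?A * indicator Q z \<partial>lborel) + (\<integral>\<^sup>+z. ennreal (?A * l powr p) * H z \<partial>lborel)"
      by (rule nn_integral_add) (use H in auto)
    also have "\<dots> = ennreal ?A * emeasure lborel Q + ennreal (?A * l powr p) * integral\<^sup>N lborel H"
      using H by (simp add: nn_integral_cmult nn_integral_cmult_indicator)
    also have "\<dots> \<le> ennreal ?A * emeasure lborel Q + ennreal (?A * l powr p) * ennreal (K * l powr (real ?n - p))"
      unfolding H_def by (intro add_left_mono mult_left_mono K) (use \<open>0 < l\<close> in auto)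
    also have "\<dots> = ennreal (?A * l ^ ?n + ?A * l powr p * (K * l powr (real ?n - p)))"
      using \<open>0 < l\<close> K(1) by (simp add: Q ennreal_mult' ennreal_plus)
    also have "?A * l ^ ?n + ?A * l powr p * (K * l powr (real ?n - p)) = C * l ^ ?n"
    proof -
      have "l powr p * l powr (real ?n - p) = l ^ ?n"
        using \<open>0 < l\<close> by (simp add: powr_add[symmetric] powr_realpow)
      thus ?thesis by (simp add: C_def algebra_simps)
    qed
    also have "ennreal \<dots> = ennreal C * emeasure lborel Q"
      using K(1) by (simp add: Q C_def ennreal_mult')
    finally show ?thesis .
  qed
  moreover have "0 \<le> C" using K(1) by (simp add: C_def)
  ultimately show thesis using that by blast
qed

section \<open>Jensen's inequality for powers\<close>

text \<open>The number \<open>a\<close> is the mean of \<open>h\<close> with respect to the weight \<open>G\<close> of total mass \<open>m\<close>. The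
  convex function \<open>t\<^sup>s\<close> lies above its tangent at \<open>a\<close>, that is,
  \<open>s a\<^sup>s\<^sup>-\<^sup>1 t \<le> t\<^sup>s + (s - 1) a\<^sup>s\<close>; integrating this at \<open>t = h y\<close> against \<open>G\<close> gives
  \<open>s a\<^sup>s m\<close> on the left. The negative term of the tangent stands on the right because the
  integrals take values in \<open>[0, \<infinity>]\<close>.\<close>

lemma powr_mean_le_nn_integral:
  fixes G h :: "'a \<Rightarrow> real"
  assumes [measurable]: "G \<in> borel_measurable M" "h \<in> borel_measurable M"
    and nonneg: "\<And>y. 0 \<le> G y" "\<And>y. 0 \<le> h y"
    and "1 \<le> s" "0 \<le> a" "0 \<le> m"
    and m: "(\<integral>\<^sup>+y. ennreal (G y) \<partial>M) = ennreal m"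
    and am: "(\<integral>\<^sup>+y. ennreal (G y * h y) \<partial>M) = ennreal (a * m)"
  shows "ennreal (a powr s * m) \<le> (\<integral>\<^sup>+y. ennreal (G y * h y powr s) \<partial>M)"
proof (cases "a = 0")
  case False
  hence "0 < a" using assms by simp
  let ?X = "\<integral>\<^sup>+y. ennreal (G y * h y powr s) \<partial>M"
  have young: "s * a powr (s - 1) * t \<le> t powr s + (s - 1) * a powr s" if "0 \<le> t" for t
  proof (cases "t = 0")
    case True
    thus ?thesis using assms by simp
  next
    case False
    hence "(t powr s) powr (1 / s) * (a powr s) powr (1 - 1 / s) \<le> 1 / s * t powr s + (1 - 1 / s) * a powr s"
      using that \<open>0 < a\<close> \<open>1 \<le> s\<close> by (intro Youngs_inequality_0) auto
    hence "s * (t * a powr (s - 1)) \<le> s * (1 / s * t powr s + (1 - 1 / s) * a powr s)"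
      using that \<open>0 < a\<close> \<open>1 \<le> s\<close> by (intro mult_left_mono) (auto simp: powr_powr right_diff_distrib)
    thus ?thesis using \<open>1 \<le> s\<close> by (simp add: algebra_simps)
  qed
  have "ennreal (a powr s * m) + ennreal ((s - 1) * a powr s * m) = ennreal (s * a powr (s - 1) * (a * m))"
  proof -
    have "a powr s = a powr (s - 1) * a"
      using \<open>0 < a\<close> by (simp add: powr_diff)
    hence "a powr s * m + (s - 1) * a powr s * m = s * a powr (s - 1) * (a * m)"
      by (simp add: algebra_simps)
    thus ?thesis using assms by (subst ennreal_plus[symmetric]) simp_all
  qed
  also have "\<dots> = ennreal (s * a powr (s - 1)) * (\<integral>\<^sup>+y. ennreal (G y * h y) \<partial>M)"
    using assms by (subst ennreal_mult') auto
  also have "\<dots> = (\<integral>\<^sup>+y. ennreal (s * a powr (s - 1)) * ennreal (G y * h y) \<partial>M)"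
    by (rule nn_integral_cmult[symmetric]) measurable
  also have "\<dots> \<le> (\<integral>\<^sup>+y. ennreal (G y * h y powr s) + ennreal ((s - 1) * a powr s) * ennreal (G y) \<partial>M)"
  proof (rule nn_integral_mono)
    fix y
    have "G y * (s * a powr (s - 1) * h y) \<le> G y * (h y powr s + (s - 1) * a powr s)"
      by (rule mult_left_mono[OF young]) (auto simp: nonneg)
    hence "ennreal (s * a powr (s - 1) * (G y * h y)) \<le> ennreal (G y * h y powr s + (s - 1) * a powr s * G y)"
      by (intro ennreal_leI) (simp add: algebra_simps)
    thus "ennreal (s * a powr (s - 1)) * ennreal (G y * h y)
      \<le> ennreal (G y * h y powr s) + ennreal ((s - 1) * a powr s) * ennreal (G y)"
      using nonneg[of y] \<open>1 \<le> s\<close> by (simp add: ennreal_mult' ennreal_plus)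
  qed
  also have "\<dots> = ?X + ennreal ((s - 1) * a powr s) * ennreal m"
    by (subst nn_integral_add) (auto simp: nn_integral_cmult m)
  also have "\<dots> = ?X + ennreal ((s - 1) * a powr s * m)"
    using assms by (simp add: ennreal_mult')
  finally have "ennreal ((s - 1) * a powr s * m) + ennreal (a powr s * m)
      \<le> ennreal ((s - 1) * a powr s * m) + ?X"
    by (simp only: add.commute)
  thus ?thesis by (simp only: ennreal_add_left_cancel_le) simp
qed simp

section \<open>The Riesz potential and its averages over cubes\<close>

text \<open>The identity also covers a divergent integral, where both sides are \<open>0\<close>: the Bochner integral
  by convention, the right side because \<open>enn2real \<infinity> = 0\<close>. So estimates of the potential from
  above by the integral in \<open>[0, \<infinity>]\<close> hold at every point.\<close>

lemma riesz_potential_1_eq_enn2real: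
  fixes g :: "real^'n \<Rightarrow> real"
  assumes [measurable]: "g \<in> borel_measurable borel" and "\<And>y. 0 \<le> g y"
  shows "riesz_potential_1 g z = enn2real (\<integral>\<^sup>+y. ennreal (g y / norm (z - y) ^ (CARD('n) - 1)) \<partial>lborel)"
proof -
  have "(\<lambda>y. g y / norm (z - y) ^ (CARD('n) - 1)) \<in> borel_measurable lborel"
    by measurable
  thus ?thesis
    unfolding riesz_potential_1_def
    by (subst integral_completion, assumption) (auto intro!: integral_eq_nn_integral simp: assms(2))
qed

lemma riesz_potential_1_nonneg:
  fixes g :: "real^'n \<Rightarrow> real"
  assumes "g \<in> borel_measurable borel" "\<And>y. 0 \<le> g y"
  shows "0 \<le> riesz_potential_1 g z"
  by (simp add: riesz_potential_1_eq_enn2real assms)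

lemma borel_measurable_riesz_potential_1:
  fixes g :: "real^'n \<Rightarrow> real"
  assumes g_meas[measurable]: "g \<in> borel_measurable borel" and g: "\<And>y. 0 \<le> g y"
  shows "riesz_potential_1 g \<in> borel_measurable borel"
  unfolding riesz_potential_1_eq_enn2real[OF g_meas g, abs_def] by measurable

text \<open>Jensen's inequality for the weight \<open>g(y) k(x, y)\<close> and the function
  \<open>k(z, y) / k(x, y) = (|x - y| / |z - y|)\<^sup>n\<^sup>-\<^sup>1\<close>, whose weighted integral is \<open>I\<^sub>1 g(z)\<close>. It takes the
  place of Minkowski's integral inequality for the norm of \<open>L\<^sup>s(Q)\<close>.\<close>

lemma riesz_potential_1_quotient_powr_le:
  fixes g :: "real^'n \<Rightarrow> real"
  assumes [measurable]: "g \<in> borel_measurable borel" and g: "\<And>y. 0 \<le> g y"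
    and "CARD('n) \<ge> 2" "1 \<le> s" "0 < m"
    and m: "(\<integral>\<^sup>+y. ennreal (g y / norm (x - y) ^ (CARD('n) - 1)) \<partial>lborel) = ennreal m"
  shows "ennreal ((riesz_potential_1 g z / m) powr s * m)
    \<le> (\<integral>\<^sup>+y. ennreal (g y / norm (x - y) ^ (CARD('n) - 1))
        * ennreal ((norm (x - y) / norm (z - y)) powr (s * (real CARD('n) - 1))) \<partial>lborel)"
proof (cases "(\<integral>\<^sup>+y. ennreal (g y / norm (z - y) ^ (CARD('n) - 1)) \<partial>lborel) = \<infinity>")
  case True
  hence "riesz_potential_1 g z = 0"
    by (simp add: riesz_potential_1_eq_enn2real g)
  thus ?thesis by simp
next
  case False
  let ?N = "CARD('n) - 1"
  define h where "h y = (norm (x - y) / norm (z - y)) ^ ?N" for y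
  have I0: "0 \<le> riesz_potential_1 g z"
    by (rule riesz_potential_1_nonneg) (auto simp: g)
  have "(\<integral>\<^sup>+y. ennreal (g y / norm (x - y) ^ ?N * h y) \<partial>lborel)
      = (\<integral>\<^sup>+y. ennreal (g y / norm (z - y) ^ ?N) \<partial>lborel)"
  proof (rule nn_integral_cong_AE, rule AE_mp[OF AE_lborel_singleton[of x]], intro AE_I2 impI)
    fix y assume "y \<noteq> x"
    thus "ennreal (g y / norm (x - y) ^ ?N * h y) = ennreal (g y / norm (z - y) ^ ?N)"
      by (simp add: h_def power_divide)
  qed
  also have "\<dots> = ennreal (riesz_potential_1 g z / m * m)"
    using False \<open>0 < m\<close> by (simp add: riesz_potential_1_eq_enn2real g less_top)
  finally have am: "(\<integral>\<^sup>+y. ennreal (g y / norm (x - y) ^ ?N * h y) \<partial>lborel)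
      = ennreal (riesz_potential_1 g z / m * m)" .
  \<comment> \<open>When the base is \<open>0\<close> this uses \<open>n \<ge> 2\<close>: for \<open>n = 1\<close> it would read \<open>1 powr s = 0 powr 0\<close>, and \<open>0 powr 0 = 0\<close>.\<close>
  have h_powr: "h y powr s = (norm (x - y) / norm (z - y)) powr (s * (real CARD('n) - 1))" for y
  proof (cases "norm (x - y) / norm (z - y) = 0")
    case True
    thus ?thesis using \<open>CARD('n) \<ge> 2\<close> by (auto simp: h_def power_0_left)
  next
    case False
    hence "0 < norm (x - y) / norm (z - y)" by auto
    thus ?thesis using \<open>CARD('n) \<ge> 2\<close>
      unfolding h_def by (simp only: powr_realpow[symmetric] powr_powr) (simp add: of_nat_diff mult.commute)
  qed
  have "ennreal ((riesz_potential_1 g z / m) powr s * m)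
    \<le> (\<integral>\<^sup>+y. ennreal (g y / norm (x - y) ^ ?N * h y powr s) \<partial>lborel)"
    using \<open>0 < m\<close> \<open>1 \<le> s\<close> I0
    by (intro powr_mean_le_nn_integral[OF _ _ _ _ _ _ _ m am]) (auto simp: h_def g)
  thus ?thesis by (simp only: h_powr ennreal_mult'' powr_ge_zero)
qed

lemma cube_borel_volume_diameter:
  fixes Q :: "(real^'n) set"
  assumes "Q \<in> cubes"
  shows "Q \<in> sets borel"
    and "\<exists>l>0. emeasure lborel Q = ennreal (l ^ CARD('n))
      \<and> (\<forall>x\<in>Q. \<forall>z\<in>Q. norm (x - z) \<le> real CARD('n) * l)"
proof -
  obtain a b l where Q: "Q = cbox a b" and l: "l > 0" "\<And>i. b $ i - a $ i = l"
    using assms unfolding cubes_def by blast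
  have ab: "a $ i \<le> b $ i" for i using l(1) l(2)[of i] by linarith
  have "Q \<noteq> {}" using ab by (auto simp: Q interval_ne_empty_cart)
  hence "measure lborel Q = l ^ CARD('n)"
    unfolding Q by (simp add: content_cbox_cart l)
  moreover have "emeasure lborel Q \<noteq> \<infinity>"
    unfolding Q using emeasure_lborel_cbox_finite[of a b] by auto
  ultimately have "emeasure lborel Q = ennreal (l ^ CARD('n))"
    by (simp add: emeasure_eq_ennreal_measure)
  moreover have "norm (x - z) \<le> real CARD('n) * l" if "x \<in> Q" "z \<in> Q" for x z
  proof -
    have "\<bar>(x - z) $ i\<bar> \<le> l" for i
      using that l(2)[of i] by (auto simp: Q mem_box_cart abs_le_iff dest!: spec[of _ i])
    hence "(\<Sum>i\<in>UNIV. \<bar>(x - z) $ i\<bar>) \<le> real CARD('n) * l"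
      by (intro sum_bounded_above) auto
    thus ?thesis using norm_le_l1_cart[of "x - z"] by linarith
  qed
  ultimately show "\<exists>l>0. emeasure lborel Q = ennreal (l ^ CARD('n))
      \<and> (\<forall>x\<in>Q. \<forall>z\<in>Q. norm (x - z) \<le> real CARD('n) * l)"
    using l(1) by blast
  show "Q \<in> sets borel" by (simp add: Q)
qed

text \<open>The potential has to be finite at \<open>x\<close>: where the integral diverges, the value of
  \<open>riesz_potential_1\<close> is \<open>0\<close> and bounds nothing.\<close>

lemma cube_average_riesz_potential_1_powr_le:
  fixes r :: real
  assumes n: "CARD('n::finite) \<ge> 2" and "0 < r" and r: "r < real CARD('n) / (real CARD('n) - 1)"
  obtains C where "0 \<le> C"
    "\<And>(g :: real^'n \<Rightarrow> real) Q x. g \<in> borel_measurable borel \<Longrightarrow> (\<And>y. 0 \<le> g y) \<Longrightarrow> Q \<in> cubes \<Longrightarrow> x \<in> Q \<Longrightarrow>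
      (\<integral>\<^sup>+y. ennreal (g y / norm (x - y) ^ (CARD('n) - 1)) \<partial>lborel) < \<infinity> \<Longrightarrow>
      (\<integral>\<^sup>+z\<in>Q. ennreal (riesz_potential_1 g z powr r) \<partial>lborel)
        \<le> ennreal (C * riesz_potential_1 g x powr r) * emeasure lborel Q"
proof -
  let ?n = "real CARD('n)" and ?N = "CARD('n) - 1"
  define s where "s = max 1 r"
  define p where "p = s * (?n - 1)"
  have s: "1 \<le> s" "r \<le> s" by (auto simp: s_def)
  have p: "0 \<le> p" "p < real DIM(real^'n)"
    using n r by (auto simp: p_def s_def max_def field_simps)
  obtain C where C: "0 \<le> C"
    "\<And>(Q::(real^'n) set) l x y. 0 < l \<Longrightarrow> Q \<in> sets borel \<Longrightarrow> emeasure lborel Q = ennreal (l ^ DIM(real^'n)) \<Longrightarrow>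
      (\<And>z. z \<in> Q \<Longrightarrow> norm (x - z) \<le> ?n * l) \<Longrightarrow>
      (\<integral>\<^sup>+z\<in>Q. ennreal ((norm (x - y) / norm (z - y)) powr p) \<partial>lborel) \<le> ennreal C * emeasure lborel Q"
    using nn_integral_kernel_ratio_le[OF p, of ?n] by auto
  have "(\<integral>\<^sup>+z\<in>Q. ennreal (riesz_potential_1 g z powr r) \<partial>lborel)
        \<le> ennreal ((1 + C) * riesz_potential_1 g x powr r) * emeasure lborel Q"
    if g_meas[measurable]: "g \<in> borel_measurable borel" and g: "\<And>y. 0 \<le> g y" and "Q \<in> cubes" "x \<in> Q"
      and fin: "(\<integral>\<^sup>+y. ennreal (g y / norm (x - y) ^ ?N) \<partial>lborel) < \<infinity>"
    for g :: "real^'n \<Rightarrow> real" and Q x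
  proof -
    let ?I = "riesz_potential_1 g"
    obtain l where l: "0 < l" and Ql: "emeasure lborel Q = ennreal (l ^ CARD('n))"
      and diam: "\<And>x z. x \<in> Q \<Longrightarrow> z \<in> Q \<Longrightarrow> norm (x - z) \<le> ?n * l"
      using cube_borel_volume_diameter(2)[OF \<open>Q \<in> cubes\<close>] by blast
    have Q[measurable]: "Q \<in> sets borel"
      by (rule cube_borel_volume_diameter(1)[OF \<open>Q \<in> cubes\<close>])
    note I_nonneg = riesz_potential_1_nonneg[OF g_meas g]
    note borel_measurable_riesz_potential_1[OF g_meas g, measurable]
    define m where "m = ?I x"
    have m: "(\<integral>\<^sup>+y. ennreal (g y / norm (x - y) ^ ?N) \<partial>lborel) = ennreal m"
      using fin by (simp add: m_def riesz_potential_1_eq_enn2real g)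
    show ?thesis
    proof (cases "m = 0")
      case True
      \<comment> \<open>The kernel is positive off \<open>x\<close>, so a potential that vanishes at one point vanishes identically.\<close>
      have "AE y in lborel. ennreal (g y / norm (x - y) ^ ?N) = 0"
        using m True by (subst nn_integral_0_iff_AE[symmetric]) auto
      with AE_lborel_singleton[of x] have "AE y in lborel. g y = 0"
      proof eventually_elim
        case (elim y)
        hence "g y / norm (x - y) ^ ?N \<le> 0" "0 < norm (x - y) ^ ?N" by (auto simp: ennreal_eq_0_iff)
        thus ?case using g[of y] by (simp add: divide_le_0_iff)
      qed
      hence "(\<integral>\<^sup>+y. ennreal (g y / norm (z - y) ^ ?N) \<partial>lborel) = 0" for z
        by (subst nn_integral_0_iff_AE) (auto elim: eventually_mono)
      hence "?I z = 0" for z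
        by (simp add: riesz_potential_1_eq_enn2real g)
      thus ?thesis by simp
    next
      case False
      hence "0 < m" using I_nonneg[of x] by (simp add: m_def)
      define G where "G y = ennreal (g y / norm (x - y) ^ ?N)" for y
      define \<rho> where "\<rho> z y = ennreal ((norm (x - y) / norm (z - y)) powr p)" for z y :: "real^'n"
      have G_int: "(\<integral>\<^sup>+y. G y \<partial>lborel) = ennreal m" unfolding G_def by (rule m)
      have [measurable]: "G \<in> borel_measurable borel" unfolding G_def by measurable
      have [measurable]: "(\<lambda>(z, y). \<rho> z y) \<in> borel_measurable (borel \<Otimes>\<^sub>M borel)"
        unfolding \<rho>_def by measurable
      define A where "A = (\<integral>\<^sup>+z\<in>Q. ennreal ((?I z / m) powr s) \<partial>lborel)"
      have "A * ennreal m = (\<integral>\<^sup>+z. ennreal ((?I z / m) powr s * m) * indicator Q z \<partial>lborel)"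
        unfolding A_def using \<open>0 < m\<close>
        by (subst nn_integral_multc[symmetric]) (auto simp: ennreal_mult' mult_ac)
      also have "\<dots> \<le> (\<integral>\<^sup>+z. (\<integral>\<^sup>+y. G y * (\<rho> z y * indicator Q z) \<partial>lborel) \<partial>lborel)"
      proof (rule nn_integral_mono)
        fix z
        show "ennreal ((?I z / m) powr s * m) * indicator Q z \<le> (\<integral>\<^sup>+y. G y * (\<rho> z y * indicator Q z) \<partial>lborel)"
          using riesz_potential_1_quotient_powr_le[OF g_meas g n s(1) \<open>0 < m\<close> m, of z]
          by (simp add: G_def \<rho>_def p_def indicator_def)
      qed
      also have "\<dots> = (\<integral>\<^sup>+y. (\<integral>\<^sup>+z. G y * (\<rho> z y * indicator Q z) \<partial>lborel) \<partial>lborel)"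
        by (rule lborel_pair.Fubini') measurable
      also have "\<dots> = (\<integral>\<^sup>+y. G y * (\<integral>\<^sup>+z\<in>Q. \<rho> z y \<partial>lborel) \<partial>lborel)"
        by (intro nn_integral_cong nn_integral_cmult) measurable
      also have "\<dots> \<le> (\<integral>\<^sup>+y. G y * (ennreal C * emeasure lborel Q) \<partial>lborel)"
        unfolding \<rho>_def using C(2)[OF l Q _ diam[OF \<open>x \<in> Q\<close>]] Ql
        by (intro nn_integral_mono mult_left_mono) auto
      also have "\<dots> = ennreal C * emeasure lborel Q * ennreal m"
        by (subst nn_integral_multc) (auto simp: G_int mult.commute)
      finally have "ennreal m * A \<le> ennreal m * (ennreal C * emeasure lborel Q)"
        by (simp only: mult.commute)
      hence A: "A \<le> ennreal C * emeasure lborel Q"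
        using \<open>0 < m\<close> by (simp add: ennreal_mult_le_mult_iff)
      have "(\<integral>\<^sup>+z\<in>Q. ennreal (?I z powr r) \<partial>lborel)
        \<le> (\<integral>\<^sup>+z. ennreal (m powr r) * (indicator Q z + ennreal ((?I z / m) powr s) * indicator Q z) \<partial>lborel)"
      proof (rule nn_integral_mono)
        fix z
        let ?t = "?I z / m"
        have "0 \<le> ?t" using I_nonneg \<open>0 < m\<close> by simp
        have "?t powr r \<le> 1 + ?t powr s"
        proof (cases "?t \<le> 1")
          case True
          hence "?t powr r \<le> 1" using \<open>0 \<le> ?t\<close> \<open>0 < r\<close> by (intro powr_le1) auto
          thus ?thesis by (simp add: add_increasing2)
        next
          case False
          hence "?t powr r \<le> ?t powr s" using s by (intro powr_mono) auto
          thus ?thesis by linarith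
        qed
        hence "m powr r * ?t powr r \<le> m powr r * (1 + ?t powr s)"
          by (intro mult_left_mono) auto
        moreover have "?I z powr r = m powr r * ?t powr r"
          using \<open>0 < m\<close> I_nonneg[of z] by (subst powr_mult[symmetric]) auto
        ultimately have "ennreal (?I z powr r) \<le> ennreal (m powr r * (1 + ?t powr s))"
          by (intro ennreal_leI) simp
        also have "\<dots> = ennreal (m powr r) * (1 + ennreal (?t powr s))"
          by (simp add: ennreal_mult' ennreal_plus)
        finally show "ennreal (?I z powr r) * indicator Q z
          \<le> ennreal (m powr r) * (indicator Q z + ennreal (?t powr s) * indicator Q z)"
          by (auto simp: indicator_def)
      qed
      also have "\<dots> = ennreal (m powr r) * (emeasure lborel Q + A)"
        unfolding A_def by (subst nn_integral_cmult, measurable) (subst nn_integral_add, auto)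
      also have "\<dots> \<le> ennreal (m powr r) * (emeasure lborel Q + ennreal C * emeasure lborel Q)"
        by (intro mult_left_mono add_left_mono A) auto
      also have "\<dots> = ennreal ((1 + C) * m powr r) * emeasure lborel Q"
        using C(1) by (simp add: ennreal_mult' ennreal_plus algebra_simps)
      finally show ?thesis by (simp add: m_def)
    qed
  qed
  thus thesis using C(1) by (intro that[of "1 + C"]) auto
qed

section \<open>The gradient of a test function\<close>

lemma nn_integral_riesz_kernel_finite:
  fixes g :: "real^'n \<Rightarrow> real"
  assumes "\<And>y. \<bar>g y\<bar> \<le> B" "bounded {y. g y \<noteq> 0}"
  shows "(\<integral>\<^sup>+y. ennreal (g y / norm (x - y) ^ (CARD('n) - 1)) \<partial>lborel) < \<infinity>"
proof -
  let ?N = "CARD('n) - 1"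
  obtain K where K:
    "\<And>(y::real^'n) l. 0 < l \<Longrightarrow> (\<integral>\<^sup>+z\<in>cball y l. ennreal (norm (z - y) powr - real ?N) \<partial>lborel)
        \<le> ennreal (K * l powr (real DIM(real^'n) - real ?N))"
    by (rule nn_integral_norm_powr_cball_le[of "real ?N", where 'a="real^'n"]) auto
  obtain l where l: "0 < l" "{y. g y \<noteq> 0} \<subseteq> cball x l"
    using bounded_subset_ballD[OF assms(2), of x] ball_subset_cball by blast
  have "0 \<le> B" using assms(1)[of 0] by linarith
  have "(\<integral>\<^sup>+y. ennreal (g y / norm (x - y) ^ ?N) \<partial>lborel)
    \<le> (\<integral>\<^sup>+y. ennreal B * (ennreal (norm (y - x) powr - real ?N) * indicator (cball x l) y) \<partial>lborel)"
  proof (rule nn_integral_mono_AE, rule AE_mp[OF AE_lborel_singleton[of x]], intro AE_I2 impI)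
    fix y assume "y \<noteq> x"
    show "ennreal (g y / norm (x - y) ^ ?N)
      \<le> ennreal B * (ennreal (norm (y - x) powr - real ?N) * indicator (cball x l) y)"
    proof (cases "g y = 0")
      case False
      hence "y \<in> cball x l" using l by auto
      have "g y / norm (x - y) ^ ?N \<le> B / norm (x - y) ^ ?N"
        using assms(1)[of y] by (intro divide_right_mono) auto
      also have "\<dots> = B * norm (y - x) powr - real ?N"
        using \<open>y \<noteq> x\<close> by (subst powr_minus, subst powr_realpow) (auto simp: norm_minus_commute divide_inverse)
      finally show ?thesis using \<open>y \<in> cball x l\<close> \<open>0 \<le> B\<close>
        by (simp add: ennreal_mult'[symmetric] ennreal_leI)
    qed simp
  qed
  also have "\<dots> = ennreal B * (\<integral>\<^sup>+y\<in>cball x l. ennreal (norm (y - x) powr - real ?N) \<partial>lborel)"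
    by (intro nn_integral_cmult borel_measurable_times_ennreal borel_measurable_indicator) auto
  also have "\<dots> \<le> ennreal B * ennreal (K * l powr (real DIM(real^'n) - real ?N))"
    by (intro mult_left_mono K l) auto
  also have "\<dots> < \<infinity>" by (simp add: ennreal_mult_less_top)
  finally show ?thesis .
qed

lemma continuous_on_norm_gradient:
  fixes f :: "real^'n \<Rightarrow> 'b::real_normed_vector"
  assumes "f \<in> Cc_infinity"
  shows "continuous_on UNIV (\<lambda>y. norm (gradient f y))"
proof -
  have "C_k (Suc 0) f" using assms by (auto simp: Cc_infinity_def simp del: C_k.simps)
  hence "continuous_on UNIV (\<lambda>y. frechet_derivative f (at y) (axis i 1))" for i
    by simp
  thus ?thesis
    unfolding gradient_def by (intro continuous_on_norm continuous_on_vec_lambda)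
qed

lemma support_gradient_subset:
  fixes f :: "real^'n \<Rightarrow> 'b::real_normed_vector"
  shows "{y. norm (gradient f y) \<noteq> 0} \<subseteq> closure {y. f y \<noteq> 0}"
proof (rule subsetI, rule ccontr)
  fix y assume y: "y \<in> {y. norm (gradient f y) \<noteq> 0}" "y \<notin> closure {y. f y \<noteq> 0}"
  have "((\<lambda>_. 0) has_derivative (\<lambda>_. 0)) (at y)" by simp
  hence "(f has_derivative (\<lambda>_. 0)) (at y)"
    by (rule has_derivative_transform_within_open[of _ _ _ _ "- closure {y. f y \<noteq> 0}"])
       (use y closure_subset[of "{y. f y \<noteq> 0}"] in auto)
  hence "frechet_derivative f (at y) = (\<lambda>_. 0)"
    by (rule frechet_derivative_at[symmetric])
  hence "gradient f y = 0" by (simp add: gradient_def vec_eq_iff)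
  thus False using y by simp
qed

lemma nn_integral_riesz_kernel_gradient_finite:
  fixes f :: "real^'n \<Rightarrow> 'b::real_normed_vector"
  assumes f: "f \<in> Cc_infinity"
  shows "(\<integral>\<^sup>+y. ennreal (norm (gradient f y) / norm (x - y) ^ (CARD('n) - 1)) \<partial>lborel) < \<infinity>"
proof -
  let ?g = "\<lambda>y. norm (gradient f y)"
  have supp: "compact (closure {y. f y \<noteq> 0})" using f by (simp add: Cc_infinity_def)
  have bdd: "bounded {y. ?g y \<noteq> 0}"
    using bounded_subset[OF compact_imp_bounded[OF supp] support_gradient_subset] .
  have "bounded (?g ` closure {y. f y \<noteq> 0})"
    by (intro compact_imp_bounded compact_continuous_image supp
        continuous_on_subset[OF continuous_on_norm_gradient[OF f]]) simp
  then obtain B where "\<forall>y\<in>closure {y. f y \<noteq> 0}. norm (?g y) \<le> B" "0 < B"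
    by (auto simp: bounded_pos)
  hence "\<bar>?g y\<bar> \<le> B" for y
    using support_gradient_subset[of f] by (cases "?g y = 0") auto
  thus ?thesis by (rule nn_integral_riesz_kernel_finite[OF _ bdd])
qed

section \<open>The maximal function of an operator dominated by the potential\<close>

theorem theorem1p9:
  fixes T :: "(real^'n \<Rightarrow> 'k::real_normed_field) \<Rightarrow> real^'n \<Rightarrow> 'k"
    and C\<^sub>0 r :: real
  assumes "CARD('n) \<ge> 2"
    and "\<And>f. f \<in> Cc_infinity \<Longrightarrow> T f \<in> borel_measurable lebesgue"
    and "\<And>f x. f \<in> Cc_infinity \<Longrightarrow>
           norm (T f x) \<le> C\<^sub>0 * riesz_potential_1 (\<lambda>y. norm (gradient f y)) x"
    and "0 < r" and "r < real CARD('n) / (real CARD('n) - 1)"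
  shows "\<exists>C::real. \<forall>f\<in>Cc_infinity. \<forall>x.
           maximal_Lr r (T f) x \<le> ennreal (C * riesz_potential_1 (\<lambda>y. norm (gradient f y)) x)"
proof -
  obtain C where C: "0 \<le> C"
    "\<And>(g :: real^'n \<Rightarrow> real) Q x. g \<in> borel_measurable borel \<Longrightarrow> (\<And>y. 0 \<le> g y) \<Longrightarrow> Q \<in> cubes \<Longrightarrow> x \<in> Q \<Longrightarrow>
      (\<integral>\<^sup>+y. ennreal (g y / norm (x - y) ^ (CARD('n) - 1)) \<partial>lborel) < \<infinity> \<Longrightarrow>
      (\<integral>\<^sup>+z\<in>Q. ennreal (riesz_potential_1 g z powr r) \<partial>lborel)
        \<le> ennreal (C * riesz_potential_1 g x powr r) * emeasure lborel Q"
    using cube_average_riesz_potential_1_powr_le[OF assms(1,4,5)] by blast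
  have "maximal_Lr r (T f) x
    \<le> ennreal (\<bar>C\<^sub>0\<bar> * C powr (1 / r) * riesz_potential_1 (\<lambda>y. norm (gradient f y)) x)"
    if f: "f \<in> Cc_infinity" for f x
    unfolding maximal_Lr_def
  proof (rule SUP_least)
    let ?g = "\<lambda>y. norm (gradient f y)"
    let ?I = "riesz_potential_1 ?g"
    fix Q assume "Q \<in> {Q \<in> cubes. x \<in> Q}"
    hence Q: "Q \<in> cubes" "x \<in> Q" by auto
    obtain l where l: "0 < l" and Ql: "emeasure lborel Q = ennreal (l ^ CARD('n))"
      using cube_borel_volume_diameter(2)[OF Q(1)] by blast
    have [measurable]: "Q \<in> sets borel"
      by (rule cube_borel_volume_diameter(1)[OF Q(1)])
    have g_meas[measurable]: "?g \<in> borel_measurable borel"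
      by (intro borel_measurable_continuous_onI continuous_on_norm_gradient f)
    have I_nonneg: "0 \<le> ?I z" for z
      by (rule riesz_potential_1_nonneg[OF g_meas]) simp
    have [measurable]: "?I \<in> borel_measurable borel"
      by (rule borel_measurable_riesz_potential_1[OF g_meas]) simp
    \<comment> \<open>The hypotheses allow \<open>C\<^sub>0 < 0\<close>, hence the absolute value.\<close>
    let ?J = "C powr (1 / r) * (\<bar>C\<^sub>0\<bar> * ?I x)"
    have "(\<integral>\<^sup>+y\<in>Q. ennreal (norm (T f y) powr r) \<partial>lebesgue)
      = (\<integral>\<^sup>+y\<in>Q. ennreal (norm (T f y) powr r) \<partial>lborel)"
      by (rule nn_integral_completion)
    also have "\<dots> \<le> (\<integral>\<^sup>+y. ennreal (\<bar>C\<^sub>0\<bar> powr r) * (ennreal (?I y powr r) * indicator Q y) \<partial>lborel)"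
    proof (rule nn_integral_mono)
      fix y
      have "norm (T f y) \<le> \<bar>C\<^sub>0\<bar> * ?I y"
        using assms(3)[OF f, of y] mult_right_mono[OF abs_ge_self I_nonneg[of y], of C\<^sub>0] by linarith
      hence "norm (T f y) powr r \<le> (\<bar>C\<^sub>0\<bar> * ?I y) powr r"
        using assms(4) by (intro powr_mono2) auto
      hence "ennreal (norm (T f y) powr r) \<le> ennreal (\<bar>C\<^sub>0\<bar> powr r) * ennreal (?I y powr r)"
        using I_nonneg[of y] by (simp add: powr_mult ennreal_mult'[symmetric] ennreal_leI)
      thus "ennreal (norm (T f y) powr r) * indicator Q y
        \<le> ennreal (\<bar>C\<^sub>0\<bar> powr r) * (ennreal (?I y powr r) * indicator Q y)"
        by (auto simp: indicator_def)
    qed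
    also have "\<dots> = ennreal (\<bar>C\<^sub>0\<bar> powr r) * (\<integral>\<^sup>+y\<in>Q. ennreal (?I y powr r) \<partial>lborel)"
      by (rule nn_integral_cmult) measurable
    also have "\<dots> \<le> ennreal (\<bar>C\<^sub>0\<bar> powr r) * (ennreal (C * ?I x powr r) * emeasure lborel Q)"
      by (intro mult_left_mono C(2) Q nn_integral_riesz_kernel_gradient_finite f) auto
    also have "\<dots> = ennreal (?J powr r * l ^ CARD('n))"
    proof -
      have "?J powr r = \<bar>C\<^sub>0\<bar> powr r * (C * ?I x powr r)"
        using C(1) I_nonneg[of x] assms(4) by (simp add: powr_mult powr_powr)
      thus ?thesis using l C(1) by (simp add: Ql ennreal_mult' mult.assoc)
    qed
    finally have num: "(\<integral>\<^sup>+y\<in>Q. ennreal (norm (T f y) powr r) \<partial>lebesgue) \<le> ennreal (?J powr r * l ^ CARD('n))" .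
    let ?avg = "(\<integral>\<^sup>+y\<in>Q. ennreal (norm (T f y) powr r) \<partial>lebesgue) / emeasure lebesgue Q"
    have "emeasure lebesgue Q = ennreal (l ^ CARD('n))"
      using Ql by simp
    hence "?avg \<le> ennreal (?J powr r * l ^ CARD('n)) / ennreal (l ^ CARD('n))"
      using num by (simp add: divide_right_mono_ennreal)
    also have "\<dots> = ennreal (?J powr r)"
      using l by (simp add: divide_ennreal)
    finally have avg: "?avg \<le> ennreal (?J powr r)" .
    hence "?avg \<noteq> \<infinity>" by (auto simp: top_unique)
    moreover have "enn2real ?avg powr (1 / r) \<le> ?J"
    proof -
      have "enn2real ?avg \<le> ?J powr r"
        using enn2real_mono[OF avg] by simp
      hence "enn2real ?avg powr (1 / r) \<le> (?J powr r) powr (1 / r)"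
        using assms(4) by (intro powr_mono2) auto
      also have "\<dots> = ?J"
        using assms(4) I_nonneg[of x] by (simp add: powr_powr)
      finally show ?thesis .
    qed
    ultimately have "ennreal_powr ?avg (1 / r) \<le> ennreal ?J"
      by (simp add: ennreal_powr_def ennreal_leI)
    thus "ennreal_powr ?avg (1 / r) \<le> ennreal (\<bar>C\<^sub>0\<bar> * C powr (1 / r) * ?I x)"
      by (simp add: mult_ac)
  qed
  thus ?thesis by blast
qed

end
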